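(* Except for trees of order $4$, every tree $T$ has a $5^*$-coloring such that every color class is an all-$4$-isolating set of $T$.
   Context: Graphs are finite and simple; the order of a graph is its number of vertices. For a graph $G$ and $S\subseteq V(G)$, $N[S]$ denotes $S$ together with all vertices adjacent to a vertex of $S$. A set $S\subseteq V(G)$ (possibly empty) is an all-$k$-isolating set of $G$ if $G-N[S]$ has no component of order at least $k$. An $\ell^*$-coloring of a graph is a weak partition of its vertex set into $\ell$ independent sets (the color classes), where color classes are allowed to be empty; that is, a proper coloring with colors $1,\dots,\ell$, not all of which need be used. *)

theory Defs
  imports "Graph_Theory.Graph_Theory"
begin

(* A finite simple graph is a pair_graph: a finite vertex set with a symmetric, loopfree
   set of ordered pairs, so that an edge uv is represented by both (u,v) and (v,u). *)

(* The library's predicates forest and tree cannot be used for symmetric digraphs: there the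
   closed walk u,v,u along a single edge already counts as a cycle.  Requiring at least
   three arcs leaves exactly the cycles of the undirected graph. *)
definition is_tree :: "'a pair_pre_digraph \<Rightarrow> bool" where
  "is_tree G \<longleftrightarrow> pair_graph G \<and> Digraph_Component.connected (with_proj G) \<and>
     \<not> (\<exists>p. pre_digraph.cycle (with_proj G) p \<and> 3 \<le> length p)"

definition closed_nbhd :: "'a pair_pre_digraph \<Rightarrow> 'a set \<Rightarrow> 'a set" where
  "closed_nbhd G S = S \<union> {v. \<exists>u\<in>S. (u, v) \<in> parcs G}"

definition is_component :: "('a, 'b) pre_digraph \<Rightarrow> ('a, 'b) pre_digraph \<Rightarrow> bool" where
  "is_component H G \<longleftrightarrow> pre_digraph.max_subgraph G Digraph_Component.connected H"

definition all_isolating :: "nat \<Rightarrow> 'a pair_pre_digraph \<Rightarrow> 'a set \<Rightarrow> bool" where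
  "all_isolating k G S \<longleftrightarrow> S \<subseteq> pverts G \<and>
     \<not> (\<exists>H. is_component H (with_proj G \<restriction> (pverts G - closed_nbhd G S)) \<and> k \<le> card (verts H))"

definition star_coloring :: "nat \<Rightarrow> 'a pair_pre_digraph \<Rightarrow> ('a \<Rightarrow> nat) \<Rightarrow> bool" where
  "star_coloring l G c \<longleftrightarrow> (\<forall>v\<in>pverts G. c v \<in> {1..l}) \<and> (\<forall>(u, v)\<in>parcs G. c u \<noteq> c v)"

definition color_class :: "'a pair_pre_digraph \<Rightarrow> ('a \<Rightarrow> nat) \<Rightarrow> nat \<Rightarrow> 'a set" where
  "color_class G c i = {v \<in> pverts G. c v = i}"

end

theory Submission
  imports Defs
begin

text \<open>
  A component of order at least 4 that avoids the closed neighbourhood of a colour class is a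
  connected set near which a colour is missing. So the task is a proper colouring in which every connected \<open>X\<close> with at least four
  vertices has all five colours on its closed neighbourhood. For a tree of order below 4 every
  injective colouring will do.

  For order at least 5, root the tree at a leaf and colour from the root downwards so that

  \<^item> a vertex of degree at least 4 sees all colours on its closed neighbourhood;

  \<^item> for an edge \<open>pv\<close> between vertices of degrees 2 and 3, or 3 and 3, or 3 and 2, the two closed
    neighbourhoods together carry all colours: the children of \<open>v\<close> receive the colours still
    missing around \<open>p\<close>;

  \<^item> five consecutive vertices of a descending path are coloured differently if the three inner
    ones have only one child each.

  To make these choices compatible, every vertex carries a palette: an ordering of the five
  colours that begins with its own and its parent's, followed by the other three in the order in
  which the children are to take them. The palettes of the children are computed from that of
  their parent by \<open>next_palette\<close>.

  Suppose a connected \<open>X\<close> with at least four vertices misses a colour. By the first property its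
  vertices have degree at most 3, and by the second a vertex of degree 3 has only leaves as
  neighbours inside \<open>X\<close>. Then \<open>X\<close> is a star, and having four vertices it is the whole tree, which
  is excluded. Otherwise \<open>X\<close> contains a descending path of four vertices, to which one adds the
  parent of its top or, if the top is the root, the child of its bottom: five colours by the
  third property. This is the content of \<open>no_large_linked_set_misses_a_colour\<close>.
\<close>

section \<open>Connectedness as a property of vertex sets\<close>

text \<open>
  Connectedness without walks: a part of \<open>X\<close> that is closed under passing to neighbours in \<open>X\<close> is
  empty or everything. In this form it bounds \<open>X\<close> from above as soon as a small closed set is
  exhibited.
\<close>

definition linked :: "('a \<times> 'a) set \<Rightarrow> 'a set \<Rightarrow> bool" where
  "linked E X \<longleftrightarrow>
     (\<forall>Y. Y \<inter> X \<noteq> {} \<longrightarrow> (\<forall>u\<in>Y \<inter> X. \<forall>v\<in>X. (u, v) \<in> E \<longrightarrow> v \<in> Y) \<longrightarrow> X \<subseteq> Y)"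

lemma linked_subset:
  assumes "linked E X" "u0 \<in> Y" "u0 \<in> X"
    and "\<And>u v. u \<in> Y \<Longrightarrow> u \<in> X \<Longrightarrow> v \<in> X \<Longrightarrow> (u, v) \<in> E \<Longrightarrow> v \<in> Y"
  shows "X \<subseteq> Y"
  using assms unfolding linked_def by blast

lemma linked_crossing:
  assumes "linked E X" "Y \<subseteq> X" "Y \<noteq> {}" "Y \<noteq> X"
  obtains u v where "u \<in> Y" "v \<in> X" "v \<notin> Y" "(u, v) \<in> E"
  using assms unfolding linked_def by (metis IntE inf.absorb_iff1 subset_antisym)

text \<open>
  The statement allows \<open>E\<close> to be larger than the arc set of \<open>H\<close>, so that components of a
  subgraph can be treated with the arcs of the ambient tree.
\<close>

lemma connected_imp_linked:
  assumes conn: "Digraph_Component.connected H"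
    and "tail H = fst" "head H = snd" "arcs H \<subseteq> E" "sym E"
  shows "linked E (verts H)"
  unfolding linked_def
proof (intro allI impI subsetI)
  fix Y x
  assume ne: "Y \<inter> verts H \<noteq> {}"
    and closed: "\<forall>u\<in>Y \<inter> verts H. \<forall>v\<in>verts H. (u, v) \<in> E \<longrightarrow> v \<in> Y"
    and x: "x \<in> verts H"
  obtain y where y: "y \<in> Y" "y \<in> verts H" using ne by blast
  have sub: "parcs (mk_symmetric H) \<subseteq> E"
    using assms by (auto simp: parcs_mk_symmetric dest: symD)
  have "y \<rightarrow>\<^sup>*\<^bsub>with_proj (mk_symmetric H)\<^esub> x"
    using conn x y by (auto simp: Digraph_Component.connected_def strongly_connected_def)
  then have "(y, x) \<in> rtrancl_on (verts H) (parcs (mk_symmetric H))"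
    by (simp add: reachable_def)
  then show "x \<in> Y"
  proof (induct rule: rtrancl_on_induct)
    case base
    then show ?case using y by simp
  next
    case (step b c)
    then show ?case using closed sub by blast
  qed
qed

section \<open>Rooted trees\<close>

text \<open>
  A root, a parent function and a depth certify a tree: \<open>arc_iff\<close> says that there are no
  arcs besides those between a vertex and its parent. This turns the colouring problem into
  a recursion along \<open>par\<close>. The values of \<open>par\<close> at the root and outside \<open>V\<close> are arbitrary.
\<close>

locale rooted_tree =
  fixes V :: "'a set" and E :: "('a \<times> 'a) set" and r :: 'a
    and par :: "'a \<Rightarrow> 'a" and dep :: "'a \<Rightarrow> nat"
  assumes fin: "finite V"
    and root_in: "r \<in> V"
    and dep_root: "dep r = 0"
    and par_in: "v \<in> V \<Longrightarrow> v \<noteq> r \<Longrightarrow> par v \<in> V"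
    and dep_par: "v \<in> V \<Longrightarrow> v \<noteq> r \<Longrightarrow> dep v = Suc (dep (par v))"
    and arc_iff: "(u, v) \<in> E \<longleftrightarrow> (v \<in> V \<and> v \<noteq> r \<and> u = par v) \<or> (u \<in> V \<and> u \<noteq> r \<and> v = par u)"
begin

definition children :: "'a \<Rightarrow> 'a set" where
  "children v = {w \<in> V. w \<noteq> r \<and> par w = v}"

lemma finite_children [simp]: "finite (children v)"
  using fin by (simp add: children_def)

lemma arc_cases:
  assumes "(u, v) \<in> E"
  obtains "v \<in> children u" | "u \<in> V" "u \<noteq> r" "v = par u"
  using assms unfolding arc_iff children_def by blast

lemma child_arc: "w \<in> children v \<Longrightarrow> (v, w) \<in> E" "w \<in> children v \<Longrightarrow> (w, v) \<in> E"
  unfolding arc_iff children_def by blast+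

lemma childD: "w \<in> children v \<Longrightarrow> w \<in> V \<and> w \<noteq> r \<and> par w = v"
  by (simp add: children_def)

lemma self_child: "v \<in> V \<Longrightarrow> v \<noteq> r \<Longrightarrow> v \<in> children (par v)"
  by (simp add: children_def)

lemma childless_deepest:
  assumes "2 \<le> card V"
  obtains l where "l \<in> V" "l \<noteq> r" "children l = {}"
proof -
  (* a vertex of maximal depth *)
  have "Max (dep ` V) \<in> dep ` V" using fin root_in by (intro Max_in) auto
  then obtain l where "l \<in> V" "dep l = Max (dep ` V)" by auto
  then have l: "l \<in> V" "\<And>v. v \<in> V \<Longrightarrow> dep v \<le> dep l" using fin by auto
  have "\<not> V \<subseteq> {r}" using assms card_mono[of "{r}" V] by auto
  then obtain v where "v \<in> V" "v \<noteq> r" by blast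
  then have "l \<noteq> r" using l dep_root dep_par by force
  moreover have "children l = {}"
    using l dep_par unfolding children_def by force
  ultimately show ?thesis using that l by blast
qed

end

lemma (in pair_graph) awalk_snoc_arc:
  assumes "awalk u p v" "(v, w) \<in> parcs G"
  shows "awalk u (p @ [(v, w)]) w" "pawalk_verts u (p @ [(v, w)]) = pawalk_verts u p @ [w]"
proof -
  have "v \<in> pverts G" "w \<in> pverts G"
    using arc_fst_in_verts[OF assms(2)] arc_snd_in_verts[OF assms(2)] by auto
  then have vw: "awalk v [(v, w)] w" using assms by (simp add: awalk_def)
  then show walk: "awalk u (p @ [(v, w)]) w" using assms by (auto intro: awalk_appendI)
  show "pawalk_verts u (p @ [(v, w)]) = pawalk_verts u p @ [w]"
  proof -
    have "pcas u p v" using assms by (simp add: awalk_def)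
    then show ?thesis by (induct p arbitrary: u) auto
  qed
qed

text \<open>
  Grow a rooted subtree one vertex at a time. Connectedness supplies a vertex \<open>w\<close> outside
  that is adjacent to the subtree; a second neighbour in the subtree would close a cycle of
  length at least 3 with a path between the two, so hanging \<open>w\<close> below its neighbour accounts for
  all new arcs.
\<close>

lemma (in pair_graph) rooted_tree_exists:
  assumes conn: "linked (parcs G) (pverts G)"
    and acyc: "\<not> (\<exists>p. cycle p \<and> 3 \<le> length p)"
    and r: "r \<in> pverts G"
  shows "\<exists>par dep. rooted_tree (pverts G) (parcs G) r par dep"
proof -
  (* the paths inside X are carried along because they produce the cycle *)
  have grow: "\<exists>X par dep. card X = Suc n \<and> X \<subseteq> pverts G \<and>
      rooted_tree X (parcs G \<inter> X \<times> X) r par dep \<and>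
      (\<forall>u\<in>X. \<forall>v\<in>X. \<exists>p. apath u p v \<and> set (pawalk_verts u p) \<subseteq> X)"
    if "Suc n \<le> card (pverts G)" for n
    using that
  proof (induct n)
    case 0
    have "rooted_tree {r} (parcs G \<inter> {r} \<times> {r}) r (\<lambda>v. v) (\<lambda>_. 0)"
      by unfold_locales (auto dest: pair_no_loops)
    moreover have "apath r [] r" using r by (simp add: apath_def awalk_def)
    ultimately show ?case using r
      by (intro exI[of _ "{r}"] exI[of _ "\<lambda>v. v"] exI[of _ "\<lambda>_. 0"]) (auto intro!: exI[of _ "[]"])
  next
    case (Suc n)
    then obtain X par dep where X: "card X = Suc n" "X \<subseteq> pverts G"
      and tree: "rooted_tree X (parcs G \<inter> X \<times> X) r par dep"
      and paths: "\<And>u v. u \<in> X \<Longrightarrow> v \<in> X \<Longrightarrow> \<exists>p. apath u p v \<and> set (pawalk_verts u p) \<subseteq> X"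
      by (metis Suc_leD)
    interpret X: rooted_tree X "parcs G \<inter> X \<times> X" r par dep by (fact tree)
    have "X \<noteq> pverts G" using X Suc by auto
    then obtain u0 w where u0: "u0 \<in> X" and w: "w \<in> pverts G" "w \<notin> X"
      and arc: "(u0, w) \<in> parcs G"
      using linked_crossing[OF conn X(2)] X.root_in by blast
    have cra: "(w, u0) \<in> parcs G"
      using arc arcs_ends_symmetric[OF pair_sym_arcs] by auto
    have only: "u = u0" if u: "u \<in> X" "(u, w) \<in> parcs G" for u
    proof (rule ccontr)
      assume "u \<noteq> u0"
      obtain p where p: "apath u0 p u" "set (pawalk_verts u0 p) \<subseteq> X"
        using paths u0 u by blast
      have "p \<noteq> []" using p \<open>u \<noteq> u0\<close> by (auto simp: apath_def awalk_def)
      have pw: "awalk u0 p u" "distinct (pawalk_verts u0 p)" using p by (auto simp: apath_def)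
      let ?c = "(w, u0) # p @ [(u, w)]"
      have "awalk w ?c w" using pw cra u w by (auto simp: awalk_simps)
      moreover have "pawalk_verts w ?c = w # pawalk_verts u0 p @ [w]"
        using awalk_snoc_arc[OF pw(1) u(2)] by simp
      moreover have "w \<notin> set (pawalk_verts u0 p)" using p w by blast
      ultimately have "cycle ?c" using pw by (auto simp: cycle_def)
      moreover have "3 \<le> length ?c" using \<open>p \<noteq> []\<close> by (cases p) auto
      ultimately show False using acyc by blast
    qed
    let ?X = "insert w X" and ?par = "par(w := u0)" and ?dep = "dep(w := Suc (dep u0))"
    have "w \<noteq> r" using w X.root_in by blast
    have only': "u = u0" if "u \<in> X" "(w, u) \<in> parcs G" for u
      using that only arcs_ends_symmetric[OF pair_sym_arcs] by auto
    have "rooted_tree ?X (parcs G \<inter> ?X \<times> ?X) r ?par ?dep"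
    proof
      show "finite ?X" "r \<in> ?X" "?dep r = 0"
        using X.fin X.root_in X.dep_root \<open>w \<noteq> r\<close> by auto
      show "?par v \<in> ?X" if "v \<in> ?X" "v \<noteq> r" for v
        using that u0 X.par_in by auto
      show "?dep v = Suc (?dep (?par v))" if "v \<in> ?X" "v \<noteq> r" for v
        using that u0 w X.par_in X.dep_par by auto
      show "(u, v) \<in> parcs G \<inter> ?X \<times> ?X \<longleftrightarrow>
          (v \<in> ?X \<and> v \<noteq> r \<and> u = ?par v) \<or> (u \<in> ?X \<and> u \<noteq> r \<and> v = ?par u)" for u v
      proof -
        have old: "(u, v) \<in> parcs G \<longleftrightarrow> (v \<noteq> r \<and> u = par v) \<or> (u \<noteq> r \<and> v = par u)"
          if "u \<in> X" "v \<in> X" using X.arc_iff[of u v] that by auto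
        have nl: "(w, w) \<notin> parcs G" using pair_no_loops by force
        have new1: "(u, w) \<in> parcs G \<longleftrightarrow> u = u0" if "u \<in> X" using that only arc by blast
        have new2: "(w, u) \<in> parcs G \<longleftrightarrow> u = u0" if "u \<in> X" for u using that only' cra by blast
        show ?thesis
          using old nl new1 new2 w u0 \<open>w \<noteq> r\<close> X.par_in by (auto split: if_splits)
      qed
    qed
    moreover have "card ?X = Suc (Suc n)" using X w X.fin by simp
    moreover have "\<exists>p. apath u p v \<and> set (pawalk_verts u p) \<subseteq> ?X" if uv: "u \<in> ?X" "v \<in> ?X" for u v
    proof -
      consider "u \<in> X" "v \<in> X" | "u = w" "v = w" | "u = w" "v \<in> X" | "u \<in> X" "v = w"
        using uv by blast
      then show ?thesis
      proof cases
        case 1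
        then show ?thesis using paths[of u v] by blast
      next
        case 2
        then show ?thesis using w by (intro exI[of _ "[]"]) (simp add: apath_def awalk_def)
      next
        case 3
        then obtain p where p: "apath u0 p v" "set (pawalk_verts u0 p) \<subseteq> X"
          using paths u0 by blast
        then have "apath w ((w, u0) # p) v" using cra w by (auto simp: apath_def awalk_Cons_iff)
        then show ?thesis using p 3 by (intro exI[of _ "(w, u0) # p"]) auto
      next
        case 4
        then obtain p where p: "apath u p u0" "set (pawalk_verts u p) \<subseteq> X"
          using paths u0 by blast
        then have "awalk u p u0" "distinct (pawalk_verts u p)" by (auto simp: apath_def)
        with awalk_snoc_arc[OF this(1) arc] p w 4 show ?thesis
          by (intro exI[of _ "p @ [(u0, w)]"]) (auto simp: apath_def)
      qed
    qed
    ultimately show ?case using X w by blast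
  qed
  have "card (pverts G) = Suc (card (pverts G) - 1)"
    using r pair_finite_verts by (metis One_nat_def Suc_pred card_gt_0_iff empty_iff)
  then obtain X par dep where "card X = card (pverts G)" "X \<subseteq> pverts G"
    and t: "rooted_tree X (parcs G \<inter> X \<times> X) r par dep"
    using grow[of "card (pverts G) - 1"] by auto
  then have "X = pverts G" using pair_finite_verts by (simp add: card_subset_eq)
  moreover have "parcs G \<inter> pverts G \<times> pverts G = parcs G"
    using arc_fst_in_verts arc_snd_in_verts by force
  ultimately show ?thesis using t by auto
qed


section \<open>The palette colouring\<close>

text \<open>
  The palette \<open>(a, b, x, y, z)\<close> of a vertex lists its own colour, the colour of its parent, and the
  other three colours in the order in which its children take them.
\<close>

type_synonym palette = "nat \<times> nat \<times> nat \<times> nat \<times> nat"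

fun entries :: "palette \<Rightarrow> nat set" where
  "entries (a, b, x, y, z) = {a, b, x, y, z}"

text \<open>
  The palette of the \<open>i\<close>-th of \<open>k\<close> children. The grandparent's colour \<open>b\<close> comes last in
  every case. With two children, the colour \<open>z\<close> that the parent does not see yet
  is the first one to be used by the grandchildren; this completes the
  neighbourhoods of an edge whose upper end has degree 3. With one child, the unused colours
  \<open>y, z\<close> keep their order: two grandchildren below the child use both, and along a path of
  single children the colours are repeated with period five. From the third child on, all
  children take the last colour; the order of their palettes is immaterial since a vertex with
  three children sees all colours.
\<close>

fun next_palette :: "nat \<Rightarrow> nat \<Rightarrow> palette \<Rightarrow> palette" where
  "next_palette k i (a, b, x, y, z) =
     (if k = 2 then (if i = 0 then (x, a, z, y, b) else (y, a, z, x, b))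
      else if i = 0 then (x, a, y, z, b)
      else if i = 1 then (y, a, x, z, b)
      else (z, a, x, y, b))"

lemma entries_next_palette: "entries (next_palette k i p) = entries p"
  by (cases p) auto

lemma five_entries_distinct:
  assumes "{a, b, x, y, z} = {1..5::nat}"
  shows "distinct [a, b, x, y, z]"
proof -
  have "card (set [a, b, x, y, z]) = length [a, b, x, y, z]" using assms by simp
  then show ?thesis by (rule card_distinct)
qed

text \<open>
  \<open>ix\<close> numbers the children of each vertex from 0.
\<close>

locale palette_tree = rooted_tree V E r par dep
  for V :: "'a set" and E r par dep +
  fixes ix :: "'a \<Rightarrow> nat" and pal :: "'a \<Rightarrow> palette"
  assumes ix: "bij_betw ix (children v) {..<card (children v)}"
    and pal_root: "entries (pal r) = {1..5}"
    and pal_child: "w \<in> children v \<Longrightarrow> pal w = next_palette (card (children v)) (ix w) (pal v)"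

lemma (in rooted_tree) palette_tree_exists: "\<exists>ix pal. palette_tree V E r par dep ix pal"
proof -
  have "\<exists>f. bij_betw f (children v) {..<card (children v)}" for v
    using ex_bij_betw_finite_nat[OF finite_children] by (simp add: atLeast0LessThan)
  then obtain f where f: "\<And>v. bij_betw (f v) (children v) {..<card (children v)}"
    by metis
  define ix where "ix w = f (par w) w" for w
  (* grow n is correct on the vertices of depth n; the root pretends to have a parent of colour 2 *)
  define grow where "grow = rec_nat (\<lambda>_. (1, 2, 3, 4, 5))
    (\<lambda>_ p w. next_palette (card (children (par w))) (ix w) (p (par w)))"
  define pal where "pal w = grow (dep w) w" for w
  have "palette_tree V E r par dep ix pal"
  proof unfold_locales
    show "bij_betw ix (children v) {..<card (children v)}" for v
      using f[of v] by (rule bij_betw_cong[THEN iffD1, rotated]) (simp add: ix_def children_def)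
    show "entries (pal r) = {1..5}"
      by (auto simp: pal_def grow_def dep_root)
    show "pal w = next_palette (card (children v)) (ix w) (pal v)" if "w \<in> children v" for v w
      using childD[OF that] dep_par[of w] by (simp add: pal_def grow_def)
  qed
  then show ?thesis by blast
qed

context palette_tree
begin

definition colour :: "'a \<Rightarrow> nat" where
  "colour v = fst (pal v)"

lemma entries_pal: "v \<in> V \<Longrightarrow> entries (pal v) = {1..5}"
proof (induct "dep v" arbitrary: v)
  case 0
  then have "v = r" using dep_par by force
  then show ?case using pal_root by simp
next
  case (Suc n)
  then have "v \<noteq> r" using dep_root by auto
  then show ?case
    using Suc dep_par[of v] par_in[of v] self_child[of v] by (simp add: pal_child entries_next_palette)
qed

lemma pal_distinct:
  assumes "v \<in> V" "pal v = (a, b, x, y, z)"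
  shows "distinct [a, b, x, y, z]"
  using entries_pal[OF assms(1)] assms(2) by (intro five_entries_distinct) simp

lemma colour_range: "v \<in> V \<Longrightarrow> colour v \<in> {1..5}"
  using entries_pal[of v] by (cases "pal v") (auto simp: colour_def)

lemma colour_par:
  assumes "v \<in> V" "v \<noteq> r"
  shows "fst (snd (pal v)) = colour (par v)"
  using pal_child[OF self_child[OF assms]] by (cases "pal (par v)") (simp add: colour_def)

lemma colour_arc:
  assumes "(u, v) \<in> E"
  shows "colour u \<noteq> colour v"
proof -
  have *: "colour (par w) \<noteq> colour w" if "w \<in> V" "w \<noteq> r" for w
    using colour_par[OF that] pal_distinct[OF that(1)] by (cases "pal w") (auto simp: colour_def)
  show ?thesis using assms *[of u] *[of v] unfolding arc_iff by auto
qed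

lemma child_of_index:
  assumes "i < card (children v)"
  obtains w where "w \<in> children v" "ix w = i"
  using ix[of v] assms unfolding bij_betw_def by (metis imageE lessThan_iff)

lemma first_child:
  assumes "children v \<noteq> {}" "pal v = (a, b, x, y, z)"
  obtains w where "w \<in> children v" "colour w = x"
proof -
  have "0 < card (children v)" using assms by (simp add: card_gt_0_iff)
  then obtain w where w: "w \<in> children v" "ix w = 0" by (rule child_of_index)
  then show ?thesis using that[of w] pal_child[OF w(1)] assms by (simp add: colour_def)
qed

lemma only_child:
  assumes "card (children v) = 1" "pal v = (a, b, x, y, z)" "w \<in> children v"
  shows "children v = {w}" "pal w = (x, a, y, z, b)"
proof -
  show "children v = {w}" using assms by (metis card_1_singletonE singletonD)
  have "ix w = 0" using bij_betwE[OF ix[of v]] assms by auto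
  then show "pal w = (x, a, y, z, b)" using pal_child[OF assms(3)] assms by simp
qed

lemma two_children:
  assumes "card (children v) = 2" "pal v = (a, b, x, y, z)"
  obtains w0 w1 where "w0 \<noteq> w1" "children v = {w0, w1}"
    "pal w0 = (x, a, z, y, b)" "pal w1 = (y, a, z, x, b)"
proof -
  obtain w0 w1 where w: "w0 \<in> children v" "ix w0 = 0" "w1 \<in> children v" "ix w1 = 1"
    using child_of_index[of 0 v] child_of_index[of 1 v] assms by (metis one_less_numeral_iff pos2 semiring_norm(76))
  then have "w0 \<noteq> w1" by auto
  moreover have "children v = {w0, w1}"
    using w \<open>w0 \<noteq> w1\<close> assms by (intro card_subset_eq[symmetric]) auto
  ultimately show ?thesis
    using that pal_child[OF w(1)] pal_child[OF w(3)] w assms by simp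
qed

lemma many_children:
  assumes "3 \<le> card (children v)" "pal v = (a, b, x, y, z)"
  obtains w0 w1 w2 where "w0 \<in> children v" "w1 \<in> children v" "w2 \<in> children v"
    "colour w0 = x" "colour w1 = y" "colour w2 = z"
proof -
  have "0 < card (children v)" "1 < card (children v)" "2 < card (children v)" using assms by auto
  then obtain w0 w1 w2 where "w0 \<in> children v" "ix w0 = 0" "w1 \<in> children v" "ix w1 = 1"
    "w2 \<in> children v" "ix w2 = 2"
    by (metis child_of_index)
  then show ?thesis
    using that[of w0 w1 w2] pal_child assms by (simp add: colour_def)
qed

text \<open>
  If \<open>X\<close> has a vertex \<open>v\<close> with two children, then \<open>X\<close> is contained in \<open>v\<close>, its children and possibly
  the root, and is too small unless it is a whole star of order 4. Otherwise \<open>X\<close> contains a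
  descending path of four vertices, whose colours are read off the palettes. At the root, the
  second colour of the palette belongs to no parent. Since the root is a leaf, it never counts
  as a branching vertex, and on a path of single children starting at the root this colour is
  the fifth to appear.
\<close>

lemma no_large_linked_set_misses_a_colour:
  assumes leaf: "card (children r) = 1"
    and V: "linked E V" "5 \<le> card V"
    and X: "X \<subseteq> V" "linked E X" "4 \<le> card X"
    and i: "i \<in> {1..5}"
    and own: "\<And>v. v \<in> X \<Longrightarrow> colour v \<noteq> i"
    and nbr: "\<And>u v. v \<in> X \<Longrightarrow> (v, u) \<in> E \<Longrightarrow> colour u \<noteq> i"
  shows False
proof -
  have finX: "finite X" using X(1) fin by (rule finite_subset)
  have child: "colour w \<noteq> i" if "v \<in> X" "w \<in> children v" for v w
    using nbr[OF that(1)] child_arc that by blast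
  have parent: "colour (par v) \<noteq> i" if "v \<in> X" "v \<noteq> r" for v
    using nbr[OF that(1)] that X(1) arc_iff by blast
  have entry: "i \<in> entries (pal v)" if "v \<in> V" for v
    using entries_pal[OF that] i by simp
  have few: "card (children v) \<le> 2" if v: "v \<in> X" for v
  proof (rule ccontr)
    assume "\<not> card (children v) \<le> 2"
    then have k: "3 \<le> card (children v)" by simp
    obtain a b x y z where pal: "pal v = (a, b, x, y, z)" by (metis prod_cases5)
    obtain w0 w1 w2 where "w0 \<in> children v" "w1 \<in> children v" "w2 \<in> children v"
      "colour w0 = x" "colour w1 = y" "colour w2 = z"
      using many_children[OF k pal] .
    moreover have "v \<noteq> r" using k leaf by auto
    moreover have "colour v = a" using pal by (simp add: colour_def)
    moreover have "colour (par v) = b" using colour_par[of v] pal v X(1) \<open>v \<noteq> r\<close> by auto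
    moreover have "i \<in> {a, b, x, y, z}" using entry[of v] pal v X(1) by auto
    ultimately show False using own child parent v by blast
  qed
  (* a vertex with two children sees every colour but the last of its palette *)
  have missing: "i = z" if v: "v \<in> X" "v \<noteq> r" and k: "card (children v) = 2"
    and pal: "pal v = (a, b, x, y, z)" for v a b x y z
  proof -
    obtain w0 w1 where "w0 \<in> children v" "w1 \<in> children v" "colour w0 = x" "colour w1 = y"
      using two_children[OF k pal] by (metis colour_def fst_conv insertI1 insertI2)
    moreover have "colour v = a" using pal by (simp add: colour_def)
    moreover have "colour (par v) = b" using colour_par[of v] pal v X(1) by auto
    moreover have "i \<in> {a, b, x, y, z}" using entry[of v] pal v X(1) by auto
    ultimately show ?thesis using own child parent v by blast
  qed
  (* the first grandchild would have the missing colour *)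
  have leaves: "children w = {}"
    if v: "v \<in> X" "v \<noteq> r" and k: "card (children v) = 2" and w: "w \<in> children v" "w \<in> X" for v w
  proof (rule ccontr)
    assume ne: "children w \<noteq> {}"
    obtain a b x y z where pal: "pal v = (a, b, x, y, z)" by (metis prod_cases5)
    obtain a' b' y' z' where "pal w = (a', b', z, y', z')"
      using two_children[OF k pal] w by (metis insertE singletonD)
    then obtain u where "u \<in> children w" "colour u = z" using first_child[OF ne] by metis
    then show False using child[OF w(2)] missing[OF v k pal] by blast
  qed
  have no_branch: "card (children v) \<le> 1" if v: "v \<in> X" for v
  proof (rule ccontr)
    assume "\<not> card (children v) \<le> 1"
    then have k: "card (children v) = 2" using few[OF v] by simp
    then have vr: "v \<noteq> r" using leaf by auto
    have vV: "v \<in> V" using v X(1) by blast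
    obtain a b x y z where pal: "pal v = (a, b, x, y, z)" by (metis prod_cases5)
    have p_root: "par v = r" if p: "par v \<in> X"
    proof (rule ccontr)
      assume pr: "par v \<noteq> r"
      (* by leaves, since v is not one *)
      have "card (children (par v)) \<noteq> 2"
        using leaves[OF p pr _ self_child[OF vV vr] v] k by auto
      moreover have "card (children (par v)) \<noteq> 0" using self_child[OF vV vr] by auto
      ultimately have k1: "card (children (par v)) = 1" using few[OF p] by linarith
      (* v is an only child, so its last colour is that of its grandparent *)
      obtain a' b' x' y' z' where ppal: "pal (par v) = (a', b', x', y', z')" by (metis prod_cases5)
      then have "z = b'" using only_child(2)[OF k1 ppal self_child[OF vV vr]] pal by simp
      then have "colour (par (par v)) = i"
        using colour_par[of "par v"] ppal missing[OF v vr k pal] p pr X(1) by auto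
      then show False using parent p pr by blast
    qed
    let ?Y = "insert v (children v)"
    have cY: "card ?Y = 3" using k childD[of v v] dep_par[OF vV vr] by (auto simp: card_insert_if)
    have down: "u \<in> ?Y \<Longrightarrow> u \<in> X \<Longrightarrow> (u, w) \<in> E \<Longrightarrow> w = par v \<or> w \<in> ?Y" for u w
      using leaves[OF v vr k] by (elim arc_cases) (auto dest: childD)
    show False
    proof (cases "par v \<in> X")
      case False
      have "X \<subseteq> ?Y"
        by (rule linked_subset[OF X(2) _ v]) (use down False in auto)
      then have "card X \<le> 3" using cY by (metis card_mono finite_children finite_insert)
      then show False using X(3) by simp
    next
      case True
      then have pr: "par v = r" by (rule p_root)
      have cr: "children r = {v}"
        using leaf self_child[OF vV vr] pr by (metis card_1_singletonE singletonD)
      let ?Z = "insert r ?Y"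
      have cZ: "card ?Z \<le> 4" 
        using card_insert_le_m1[of 4 ?Y r] cY by simp
      have closed: "u \<in> ?Z \<Longrightarrow> u \<in> X \<Longrightarrow> (u, w) \<in> E \<Longrightarrow> w \<in> ?Z" for u w
      proof (cases "u \<in> ?Y")
        case True
        assume "u \<in> X" "(u, w) \<in> E"
        then show ?thesis using down[OF True] pr by blast
      next
        case False
        assume "u \<in> ?Z" "(u, w) \<in> E"
        then have "w \<in> children r" using False by (elim arc_cases) auto
        then show ?thesis using cr by blast
      qed
      have "X \<subseteq> ?Z"
        by (rule linked_subset[OF X(2) _ v]) (use closed in auto)
      then have "X = ?Z" using cZ X(3) by (intro card_seteq) auto
      then have "V \<subseteq> ?Z"
        by (intro linked_subset[OF V(1) _ vV]) (use closed in auto)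
      then have "card V \<le> 4" using cZ by (meson card_mono finite_children finite_insert le_trans)
      then show False using V(2) by simp
    qed
  qed
  (* from here on X can only be a descending path *)
  obtain t where t: "t \<in> X" "\<And>v. v \<in> X \<Longrightarrow> dep t \<le> dep v"
  proof -
    have "Min (dep ` X) \<in> dep ` X" using finX X(3) by (intro Min_in) auto
    then obtain t where "t \<in> X" "dep t = Min (dep ` X)" by auto
    then show ?thesis using that finX by auto
  qed
  have top: "par t \<notin> X" if "t \<noteq> r"
    using that t(1) t(2)[of "par t"] dep_par[of t] X(1) by auto
  (* ys is an initial segment of the path and u its bottom vertex *)
  have descend: "\<exists>w. w \<in> X \<and> children u = {w}"
    if u: "u \<in> X" and uY: "u \<in> set ys" and Y: "set ys \<subseteq> X" "length ys < 4"
      and others: "\<And>v. v \<in> set ys \<Longrightarrow> v \<noteq> u \<Longrightarrow> children v \<subseteq> set ys"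
      and up: "\<And>v. v \<in> set ys \<Longrightarrow> v \<noteq> t \<Longrightarrow> par v \<in> set ys" for u ys
  proof -
    have "set ys \<noteq> X" using Y X(3) card_length[of ys] by auto
    moreover have "set ys \<noteq> {}" using uY by auto
    ultimately obtain v w where vw: "v \<in> set ys" "w \<in> X" "w \<notin> set ys" "(v, w) \<in> E"
      using linked_crossing[OF X(2) Y(1)] by metis
    from vw(4) have "w \<in> children u"
    proof (cases rule: arc_cases)
      case 1
      then show ?thesis using others vw by blast
    next
      case 2
      then show ?thesis using up vw top by blast
    qed
    moreover have "card (children u) = 1"
      proof -
      have "card (children u) \<noteq> 0" using \<open>w \<in> children u\<close> by auto
      then show ?thesis using no_branch[OF u] by linarith
    qed
    ultimately show ?thesis using vw by (metis card_1_singletonE singletonD)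
  qed
  obtain c0 c1 x y z where pal_t: "pal t = (c0, c1, x, y, z)" by (metis prod_cases5)
  obtain a where a: "a \<in> X" "children t = {a}"
    using descend[of t "[t]"] t by auto
  have pa: "par a = t" using a childD[of a t] by auto
  obtain b where b: "b \<in> X" "children a = {b}"
    using descend[of a "[t, a]"] t a pa by auto
  have pb: "par b = a" using b childD[of b a] by auto
  obtain d where d: "d \<in> X" "children b = {d}"
    using descend[of b "[t, a, b]"] t a b pa pb by auto
  have pd: "par d = b" using d childD[of d b] by auto
  have pal_a: "pal a = (x, c0, y, z, c1)" using only_child(2)[OF _ pal_t] a by simp
  have pal_b: "pal b = (y, x, z, c1, c0)" using only_child(2)[OF _ pal_a] b by simp
  have pal_d: "pal d = (z, y, c1, c0, x)" using only_child(2)[OF _ pal_b] d by simp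
  have "i \<in> {c0, c1, x, y, z}" using entry[of t] pal_t t(1) X(1) by auto
  moreover have "i \<notin> {c0, x, y, z}"
    using own[OF t(1)] own[OF a(1)] own[OF b(1)] own[OF d(1)] pal_t pal_a pal_b pal_d
    by (auto simp: colour_def)
  ultimately have ic1: "i = c1" by blast
  show False
  proof (cases "t = r")
    case False
    then have "colour (par t) = c1" using colour_par[of t] pal_t t(1) X(1) by auto
    then show False using parent[OF t(1) False] ic1 by simp
  next
    case True
    (* otherwise the tree would be the path t, a, b, d of order 4 *)
    have "children d \<noteq> {}"
    proof
      assume leaf_d: "children d = {}"
      have closed: "w \<in> {t, a, b, d}" if "u \<in> {t, a, b, d}" "(u, w) \<in> E" for u w
        using that(2)
      proof (cases rule: arc_cases)
        case 1
        then show ?thesis using that(1) a b d leaf_d by auto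
      next
        case 2
        then show ?thesis using that(1) pa pb pd True by auto
      qed
      have "V \<subseteq> {t, a, b, d}"
        using t(1) X(1) by (intro linked_subset[OF V(1), of t]) (use closed in auto)
      then have "card V \<le> card {t, a, b, d}" by (intro card_mono) auto
      also have "\<dots> \<le> 4" by (simp add: card_insert_if)
      finally show False using V(2) by simp
    qed
    then obtain e where "e \<in> children d" "colour e = c1" using first_child[OF _ pal_d] by metis
    then show False using child[OF d(1)] ic1 by blast
  qed
qed

end

section \<open>Trees without exactly four vertices\<close>

lemma small_all_isolating:
  assumes "finite (pverts T)" "card (pverts T) < k" "S \<subseteq> pverts T"
  shows "all_isolating k T S"
  unfolding all_isolating_def is_component_def
proof (intro conjI notI)
  assume "\<exists>H. pre_digraph.max_subgraph (with_proj T \<restriction> (pverts T - closed_nbhd T S))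
    Digraph_Component.connected H \<and> k \<le> card (verts H)"
  then obtain H where "subgraph H (with_proj T \<restriction> (pverts T - closed_nbhd T S))" "k \<le> card (verts H)"
    by (auto simp: pre_digraph.max_subgraph_def)
  moreover from this have "card (verts H) \<le> card (pverts T)"
    using assms by (intro card_mono) (auto simp: subgraph_def)
  ultimately show False using assms by simp
qed (fact assms)

lemma all_isolatingI:
  assumes "pair_graph T" "S \<subseteq> pverts T"
    and no: "\<And>X. X \<subseteq> pverts T - closed_nbhd T S \<Longrightarrow> linked (parcs T) X \<Longrightarrow> k \<le> card X \<Longrightarrow> False"
  shows "all_isolating k T S"
  unfolding all_isolating_def is_component_def
proof (intro conjI notI)
  interpret pair_graph T by fact
  assume "\<exists>H. pre_digraph.max_subgraph (with_proj T \<restriction> (pverts T - closed_nbhd T S))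
    Digraph_Component.connected H \<and> k \<le> card (verts H)"
  then obtain H where sub: "subgraph H (with_proj T \<restriction> (pverts T - closed_nbhd T S))"
    and conn: "Digraph_Component.connected H" and k: "k \<le> card (verts H)"
    by (auto simp: pre_digraph.max_subgraph_def)
  have "sym (parcs T)" using pair_sym_arcs by (simp add: symmetric_def)
  then have "linked (parcs T) (verts H)"
    using sub by (intro connected_imp_linked[OF conn]) (auto simp: subgraph_def compatible_def)
  moreover have "verts H \<subseteq> pverts T - closed_nbhd T S" using sub by (auto simp: subgraph_def)
  ultimately show False using no k by blast
qed (fact assms)

theorem theorem6:
  fixes T :: "'a pair_pre_digraph"
  assumes "is_tree T"
    and "card (pverts T) \<noteq> 4"
  shows "\<exists>c. star_coloring 5 T c \<and> (\<forall>i\<in>{1..5}. all_isolating 4 T (color_class T c i))"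
proof -
  interpret pair_graph T using assms by (simp add: is_tree_def)
  have sym: "sym (parcs T)" using pair_sym_arcs by (simp add: symmetric_def)
  have acyc: "\<not> (\<exists>p. cycle p \<and> 3 \<le> length p)" using assms by (simp add: is_tree_def)
  have conn: "linked (parcs T) (pverts T)"
    using connected_imp_linked[of "with_proj T" "parcs T"] assms sym by (simp add: is_tree_def)
  have class_sub: "color_class T c i \<subseteq> pverts T" for c i by (auto simp: color_class_def)
  show ?thesis
  proof (cases "card (pverts T) < 4")
    case True
    obtain f where f: "bij_betw f (pverts T) {0..<card (pverts T)}"
      using ex_bij_betw_finite_nat[OF pair_finite_verts] by blast
    have "star_coloring 5 T (\<lambda>v. Suc (f v))"
      unfolding star_coloring_def
    proof (intro conjI ballI)
      show "Suc (f v) \<in> {1..5}" if "v \<in> pverts T" for v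
        using bij_betwE[OF f] that True by fastforce
      show "case e of (u, v) \<Rightarrow> Suc (f u) \<noteq> Suc (f v)" if "e \<in> parcs T" for e
      proof -
        have "f (fst e) \<noteq> f (snd e)"
          using f pair_no_loops[OF that] arc_fst_in_verts[OF that] arc_snd_in_verts[OF that]
          by (meson bij_betw_imp_inj_on inj_on_contraD)
        then show ?thesis by (simp add: case_prod_unfold)
      qed
    qed
    then show ?thesis
      using small_all_isolating[OF pair_finite_verts True class_sub] by blast
  next
    case False
    then have five: "5 \<le> card (pverts T)" using assms by simp
    then obtain r0 where r0: "r0 \<in> pverts T" by fastforce
    (* a first, arbitrary root only serves to find a leaf l, which becomes the root *)
    obtain par0 dep0 where "rooted_tree (pverts T) (parcs T) r0 par0 dep0"
      using rooted_tree_exists[OF conn acyc r0] by blast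
    then interpret T0: rooted_tree "pverts T" "parcs T" r0 par0 dep0 .
    obtain l where l: "l \<in> pverts T" "l \<noteq> r0" "T0.children l = {}"
      using T0.childless_deepest five by auto
    have nbrs_l: "v = par0 l" if "(l, v) \<in> parcs T" for v
      using that l by (elim T0.arc_cases) auto
    obtain par dep where "rooted_tree (pverts T) (parcs T) l par dep"
      using rooted_tree_exists[OF conn acyc l(1)] by blast
    then interpret T: rooted_tree "pverts T" "parcs T" l par dep .
    have "T.children l = {par0 l}"
    proof
      show "T.children l \<subseteq> {par0 l}" using nbrs_l T.child_arc(1) by blast
      have "(l, par0 l) \<in> parcs T" using l T0.arc_iff by blast
      then have "par0 l \<in> T.children l" using T.arc_cases by blast
      then show "{par0 l} \<subseteq> T.children l" by simp
    qed
    then have leaf: "card (T.children l) = 1" by simp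
    obtain ix pal where "palette_tree (pverts T) (parcs T) l par dep ix pal"
      using T.palette_tree_exists by blast
    then interpret P: palette_tree "pverts T" "parcs T" l par dep ix pal .
    have "star_coloring 5 T P.colour"
      unfolding star_coloring_def using P.colour_range P.colour_arc by auto
    moreover have "all_isolating 4 T (color_class T P.colour i)" if i: "i \<in> {1..5}" for i
    proof (rule all_isolatingI[OF _ class_sub])
      show "pair_graph T" by unfold_locales
      fix X
      assume X: "X \<subseteq> pverts T - closed_nbhd T (color_class T P.colour i)"
        "linked (parcs T) X" "4 \<le> card X"
      show False
      proof (rule P.no_large_linked_set_misses_a_colour[OF leaf conn five _ X(2,3) i])
        show "X \<subseteq> pverts T" using X by blast
        show "P.colour v \<noteq> i" if "v \<in> X" for v
          using that X(1) by (auto simp: closed_nbhd_def color_class_def)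
        show "P.colour u \<noteq> i" if "v \<in> X" "(v, u) \<in> parcs T" for u v
        proof
          assume "P.colour u = i"
          moreover have "(u, v) \<in> parcs T" using sym that by (auto dest: symD)
          moreover have "u \<in> pverts T" using arc_snd_in_verts[OF that(2)] by simp
          ultimately show False using that X(1) by (auto simp: closed_nbhd_def color_class_def)
        qed
      qed
    qed
    ultimately show ?thesis by blast
  qed
qed

end
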